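(* For every $x\in\mathbb S$, the transition rate $q_{xx}=\lim_{t\searrow 0}\frac{p_{xx}(t)-1}{t}$ exists and $$q_{xx}=-\frac{1}{\gamma_x}.$$
   Context: Let $\mathbb S$ be a countably infinite set, $\infty$ a symbol not in $\mathbb S$, and $\bar{\mathbb S}=\mathbb S\cup\{\infty\}$. The parameters are strictly positive reals $\{\gamma_x,\lambda_x:x\in\mathbb S\}$ and a constant $c\ge 0$, with $\sum_{x\in\mathbb S}\lambda_x=\infty$ and $\sum_{x\in\mathbb S}\lambda_x\gamma_x<\infty$; set $\gamma_\infty=0$. On a probability space $(\Omega,\mathcal F,\mathbb P)$ let the following be independent: a family $\{N_x:x\in\mathbb S\}$ of independent Poisson processes on $\mathbb R^+$, $N_x$ of rate $\lambda_x$ with marks $0<\sigma^x_1<\sigma^x_2<\cdots$ ($N_x(t)$ is the number of marks in $[0,t]$), and a family $\{T_0\}\cup\{T^x_n:n\ge 1,x\in\mathbb S\}$ of i.i.d. exponential random variables of rate $1$. Clock process: for $y\in\bar{\mathbb S}$, $t\ge 0$, $\Gamma^y(t)=\gamma_yT_0+\sum_{z\in\mathbb S}\sum_{i=1}^{N_z(t)}\gamma_zT^z_i+ct$ (empty sums are $0$), and $\Gamma^y(s-)$ denotes its left limit at $s$. K process with initial state $y\in\bar{\mathbb S}$: $X^y(t)=y$ if $t<\gamma_yT_0$; $X^y(t)=x$ (with $x\in\mathbb S$) if $t\in\bigcup_{i\ge 1}[\Gamma^y(\sigma^x_i-),\Gamma^y(\sigma^x_i))$; $X^y(t)=\infty$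 otherwise. Transition functions: $p_{xy}(t)=\mathbb P(X^x(t)=y)$ for $x,y\in\bar{\mathbb S}$, $t\ge 0$. *)

theory Defs
  imports "HOL-Probability.Probability"
begin

text \<open>
  The countably infinite set of states is a type \<open>'s :: countable\<close> with infinite universe. The
  extended state space is \<open>'s option\<close>, with \<^const>\<open>None\<close> in the role of \<open>\<infinity>\<close>.
  Marks and holding times are indexed from 1 on; their values at index 0 are never used.
\<close>

definition counting :: "(nat \<Rightarrow> 'w \<Rightarrow> real) \<Rightarrow> real \<Rightarrow> 'w \<Rightarrow> nat" where
  "counting \<sigma> t \<omega> = card {i. 1 \<le> i \<and> \<sigma> i \<omega> \<le> t}"

text \<open>
  The random times \<open>\<sigma> 1 < \<sigma> 2 < \<dots>\<close> are the marks of a Poisson process of rate \<open>r\<close>. By the finiteness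
  condition, the cardinality in \<^const>\<open>counting\<close> is a true count, and is nondecreasing
  in \<open>t\<close>, so the subtraction of natural numbers below does not truncate.
\<close>

definition poisson_marks :: "'w measure \<Rightarrow> real \<Rightarrow> (nat \<Rightarrow> 'w \<Rightarrow> real) \<Rightarrow> bool" where
  "poisson_marks M r \<sigma> \<longleftrightarrow>
     (\<forall>i\<ge>1. \<sigma> i \<in> borel_measurable M) \<and>
     (\<forall>\<omega>\<in>space M.
        (\<forall>i\<ge>1. 0 < \<sigma> i \<omega> \<and> \<sigma> i \<omega> < \<sigma> (Suc i) \<omega>) \<and>
        (\<forall>t. finite {i. 1 \<le> i \<and> \<sigma> i \<omega> \<le> t})) \<and>
     (\<forall>s t. 0 \<le> s \<and> s < t \<longrightarrow>
        distr M (count_space UNIV) (\<lambda>\<omega>. counting \<sigma> t \<omega> - counting \<sigma> s \<omega>)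
          = measure_pmf (poisson_pmf (r * (t - s)))) \<and>
     (\<forall>n (\<tau> :: nat \<Rightarrow> real). 0 \<le> \<tau> 0 \<and> (\<forall>k<n. \<tau> k \<le> \<tau> (Suc k)) \<longrightarrow>
        prob_space.indep_vars M (\<lambda>_. count_space UNIV)
          (\<lambda>k \<omega>. counting \<sigma> (\<tau> (Suc k)) \<omega> - counting \<sigma> (\<tau> k) \<omega>) {..<n})"

text \<open>
  The sources of randomness are the processes \<open>N\<^sub>x\<close>, the variable \<open>T\<^sub>0\<close>, and the variables \<open>T\<^sup>x\<^sub>n\<close>
  with \<open>n \<ge> 1\<close>. Since they take values in different spaces, their joint independence is that of
  the \<open>\<sigma>\<close>-algebras they generate.
\<close>

datatype 's source = Marks 's | Initial | Holding 's nat

fun source_events ::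
  "'w measure \<Rightarrow> ('s \<Rightarrow> nat \<Rightarrow> 'w \<Rightarrow> real) \<Rightarrow> ('w \<Rightarrow> real) \<Rightarrow> ('s \<Rightarrow> nat \<Rightarrow> 'w \<Rightarrow> real) \<Rightarrow>
    's source \<Rightarrow> 'w set set" where
  "source_events M \<sigma> T\<^sub>0 T (Marks x) =
     sigma_sets (space M) {counting (\<sigma> x) t -` A \<inter> space M | t A. 0 \<le> t}"
| "source_events M \<sigma> T\<^sub>0 T Initial =
     sigma_sets (space M) {T\<^sub>0 -` A \<inter> space M | A. A \<in> sets borel}"
| "source_events M \<sigma> T\<^sub>0 T (Holding x n) =
     sigma_sets (space M) {T x n -` A \<inter> space M | A. A \<in> sets borel}"

definition independent_sources ::
  "'w measure \<Rightarrow> ('s \<Rightarrow> nat \<Rightarrow> 'w \<Rightarrow> real) \<Rightarrow> ('w \<Rightarrow> real) \<Rightarrow> ('s \<Rightarrow> nat \<Rightarrow> 'w \<Rightarrow> real) \<Rightarrow> bool" where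
  "independent_sources M \<sigma> T\<^sub>0 T \<longleftrightarrow>
     prob_space.indep_sets M (source_events M \<sigma> T\<^sub>0 T)
       (range Marks \<union> {Initial} \<union> {Holding x n | x n. 1 \<le> n})"

definition gamma_bar :: "('s \<Rightarrow> real) \<Rightarrow> 's option \<Rightarrow> real" where
  "gamma_bar \<gamma> y = (case y of None \<Rightarrow> 0 | Some x \<Rightarrow> \<gamma> x)"

text \<open>
  The clock is valued in \<open>[0, \<infinity>]\<close>, so that the infinite sum over the states makes sense for every
  outcome. It is almost surely finite, and \<^const>\<open>ennreal\<close> truncates negative
  values of the exponential variables, which have probability 0.
\<close>

definition clock ::
  "('s \<Rightarrow> real) \<Rightarrow> real \<Rightarrow> ('s \<Rightarrow> nat \<Rightarrow> 'w \<Rightarrow> real) \<Rightarrow> ('w \<Rightarrow> real) \<Rightarrow> ('s \<Rightarrow> nat \<Rightarrow> 'w \<Rightarrow> real) \<Rightarrow>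
    's option \<Rightarrow> real \<Rightarrow> 'w \<Rightarrow> ennreal" where
  "clock \<gamma> c \<sigma> T\<^sub>0 T y t \<omega> =
     ennreal (gamma_bar \<gamma> y * T\<^sub>0 \<omega>)
     + (\<Sum>\<^sub>\<infinity>z. \<Sum>i = 1..counting (\<sigma> z) t \<omega>. ennreal (\<gamma> z * T z i \<omega>))
     + ennreal (c * t)"

definition clock_left ::
  "('s \<Rightarrow> real) \<Rightarrow> real \<Rightarrow> ('s \<Rightarrow> nat \<Rightarrow> 'w \<Rightarrow> real) \<Rightarrow> ('w \<Rightarrow> real) \<Rightarrow> ('s \<Rightarrow> nat \<Rightarrow> 'w \<Rightarrow> real) \<Rightarrow>
    's option \<Rightarrow> real \<Rightarrow> 'w \<Rightarrow> ennreal" where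
  "clock_left \<gamma> c \<sigma> T\<^sub>0 T y s \<omega> = Lim (at_left s) (\<lambda>t. clock \<gamma> c \<sigma> T\<^sub>0 T y t \<omega>)"

definition constancy_set ::
  "('s \<Rightarrow> real) \<Rightarrow> real \<Rightarrow> ('s \<Rightarrow> nat \<Rightarrow> 'w \<Rightarrow> real) \<Rightarrow> ('w \<Rightarrow> real) \<Rightarrow> ('s \<Rightarrow> nat \<Rightarrow> 'w \<Rightarrow> real) \<Rightarrow>
    's option \<Rightarrow> 's \<Rightarrow> 'w \<Rightarrow> ennreal set" where
  "constancy_set \<gamma> c \<sigma> T\<^sub>0 T y x \<omega> =
     (\<Union>i\<in>{1..}. {clock_left \<gamma> c \<sigma> T\<^sub>0 T y (\<sigma> x i \<omega>) \<omega> ..< clock \<gamma> c \<sigma> T\<^sub>0 T y (\<sigma> x i \<omega>) \<omega>})"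

text \<open>
  Almost surely no two of the Poisson processes have a common mark, and then the sets
  \<^const>\<open>constancy_set\<close> of different states are disjoint. The unique existence below
  only fixes a value on the null event where this fails and the clause for \<open>x\<close> is ambiguous.
\<close>

definition K_process ::
  "('s \<Rightarrow> real) \<Rightarrow> real \<Rightarrow> ('s \<Rightarrow> nat \<Rightarrow> 'w \<Rightarrow> real) \<Rightarrow> ('w \<Rightarrow> real) \<Rightarrow> ('s \<Rightarrow> nat \<Rightarrow> 'w \<Rightarrow> real) \<Rightarrow>
    's option \<Rightarrow> real \<Rightarrow> 'w \<Rightarrow> 's option" where
  "K_process \<gamma> c \<sigma> T\<^sub>0 T y t \<omega> =
     (if t < gamma_bar \<gamma> y * T\<^sub>0 \<omega> then y
      else if \<exists>!x. ennreal t \<in> constancy_set \<gamma> c \<sigma> T\<^sub>0 T y x \<omega>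
        then Some (THE x. ennreal t \<in> constancy_set \<gamma> c \<sigma> T\<^sub>0 T y x \<omega>)
      else None)"

definition transition ::
  "'w measure \<Rightarrow> ('s \<Rightarrow> real) \<Rightarrow> real \<Rightarrow> ('s \<Rightarrow> nat \<Rightarrow> 'w \<Rightarrow> real) \<Rightarrow> ('w \<Rightarrow> real) \<Rightarrow>
    ('s \<Rightarrow> nat \<Rightarrow> 'w \<Rightarrow> real) \<Rightarrow> 's option \<Rightarrow> 's option \<Rightarrow> real \<Rightarrow> real" where
  "transition M \<gamma> c \<sigma> T\<^sub>0 T x y t =
     measure M {\<omega> \<in> space M. K_process \<gamma> c \<sigma> T\<^sub>0 T x t \<omega> = y}"

end

theory Submission
  imports Defs
begin

text \<open>
  Started at \<open>x\<close>, the process stays there during the initial holding time \<open>\<gamma> x * T\<^sub>0\<close>, which is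
  exponential with mean \<open>\<gamma> x\<close>. Hence \<open>p\<^sub>x\<^sub>x(t)\<close> is \<open>exp (- t / \<gamma> x)\<close>, whose derivative at 0 is
  \<open>- 1 / \<gamma> x\<close>, plus the probability of having left \<open>x\<close> and being back there at time \<open>t\<close>
  (\<open>transition_self\<close>). It remains to see that this return probability is \<open>o(t)\<close>
  (\<open>prob_return_little_o\<close>).

  Leaving before time \<open>t\<close> has probability at most \<open>t / \<gamma> x\<close>, so another factor tending to 0 is
  needed. To be back at \<open>x\<close>, the clock must not exceed \<open>t\<close> just before some mark of \<open>N\<^sub>x\<close>. Fix a
  small \<open>\<epsilon>\<close> and a finite set \<open>F\<close> of states. Unless \<open>N\<^sub>x\<close> has a mark in \<open>[0, \<epsilon>]\<close>, or no process
  \<open>N\<^sub>z\<close> with \<open>z\<close> in \<open>F\<close> has one, the clock at that moment contains the first holding time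
  \<open>\<gamma> z * T z 1\<close> of some \<open>z\<close> in \<open>F\<close>, which must then be at most \<open>t\<close> (\<open>return_subset\<close>).
  Each of these three alternatives is independent of \<open>T\<^sub>0\<close>. The first has probability at most
  \<open>rate x * \<epsilon>\<close>; the second has probability \<open>exp (- \<epsilon> * sum rate F)\<close>, which is as small as desired
  for a suitable \<open>F\<close> because the rates sum to infinity; for these fixed \<open>\<epsilon>\<close> and \<open>F\<close> the third has
  probability \<open>O(t)\<close> (\<open>prob_return_le\<close>).

  The events \<open>X(t) = x\<close> also have to be shown measurable, since \<^const>\<open>measure\<close> gives the value 0 to
  nonmeasurable sets. This rests on the clock being monotone in time for every outcome: its left
  limits then exist even where it is infinite, and they are limits along a sequence.
\<close>

section \<open>Monotone functions and the exponential function\<close>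

lemma one_minus_exp_le: "1 - exp (- u) \<le> (u::real)"
  using exp_ge_add_one_self[of "- u"] by simp

lemma mono_tendsto_at_left:
  fixes f :: "real \<Rightarrow> 'a::{complete_linorder, linorder_topology}"
  assumes "mono f"
  shows "(f \<longlongrightarrow> (SUP t\<in>{..<s}. f t)) (at_left s)"
proof (rule order_tendstoI)
  fix a assume "a < (SUP t\<in>{..<s}. f t)"
  then obtain u where u: "u < s" "a < f u"
    by (auto simp: less_SUP_iff)
  have "\<forall>\<^sub>F t in at_left s. t \<in> {u<..<s}"
    by (rule eventually_at_leftI[OF _ u(1)]) simp
  then show "\<forall>\<^sub>F t in at_left s. a < f t"
  proof eventually_elim
    case (elim t)
    then show ?case
      using u(2) monoD[OF assms, of u t] by auto
  qed
next
  fix a assume a: "(SUP t\<in>{..<s}. f t) < a"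
  have "\<forall>\<^sub>F t in at_left s. t \<in> {s - 1<..<s}"
    by (rule eventually_at_leftI[of "s - 1"]) auto
  then show "\<forall>\<^sub>F t in at_left s. f t < a"
  proof eventually_elim
    case (elim t)
    then have "f t \<le> (SUP t\<in>{..<s}. f t)"
      by (intro SUP_upper) auto
    then show ?case
      using a by order
  qed
qed

section \<open>Sums of nonnegative extended reals over a countable type\<close>

lemma infsum_ennreal_eq_SUP:
  fixes f :: "'a \<Rightarrow> ennreal"
  shows "(\<Sum>\<^sub>\<infinity>z. f z) = (SUP F\<in>{F. finite F}. \<Sum>z\<in>F. f z)"
  by (subst nonneg_infsum_complete) simp_all

lemma infsum_ennreal_ge_term:
  fixes f :: "'a \<Rightarrow> ennreal"
  shows "f z \<le> (\<Sum>\<^sub>\<infinity>z. f z)"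
  unfolding infsum_ennreal_eq_SUP by (rule SUP_upper2[of "{z}"]) auto

text \<open>
  A countable type has only countably many finite subsets, so the supremum of the finite partial
  sums is a countable one.
\<close>

lemma borel_measurable_infsum_ennreal:
  fixes f :: "'a::countable \<Rightarrow> 'w \<Rightarrow> ennreal"
  assumes [measurable]: "\<And>z. f z \<in> borel_measurable M"
  shows "(\<lambda>\<omega>. \<Sum>\<^sub>\<infinity>z. f z \<omega>) \<in> borel_measurable M"
  unfolding infsum_ennreal_eq_SUP
  by (intro borel_measurable_SUP countable_Collect_finite) measurable

lemma infsum_ennreal_infinite_obtains:
  fixes r :: "'a \<Rightarrow> real"
  assumes "(\<Sum>\<^sub>\<infinity>z. ennreal (r z)) = \<infinity>" "\<And>z. 0 \<le> r z"
  obtains F where "finite F" "b < (\<Sum>z\<in>F. r z)"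
proof -
  have "ennreal b < (SUP F\<in>{F. finite F}. \<Sum>z\<in>F. ennreal (r z))"
    unfolding infsum_ennreal_eq_SUP[symmetric] assms(1) by simp
  then obtain F where F: "finite F" "ennreal b < (\<Sum>z\<in>F. ennreal (r z))"
    by (auto simp: less_SUP_iff)
  have "ennreal b < ennreal (\<Sum>z\<in>F. r z)"
    using F assms(2) by (simp add: sum_ennreal)
  then have "b < (\<Sum>z\<in>F. r z)"
    by (meson ennreal_leI not_less)
  with F(1) that show thesis by blast
qed

section \<open>Marks of a Poisson process\<close>

context
  fixes M :: "'w measure" and r :: real and \<sigma> :: "nat \<Rightarrow> 'w \<Rightarrow> real"
  assumes marks: "poisson_marks M r \<sigma>"
begin

lemma poisson_marks_measurable: "1 \<le> i \<Longrightarrow> \<sigma> i \<in> borel_measurable M"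
  using marks by (simp add: poisson_marks_def)

lemma poisson_marks_pos: "\<omega> \<in> space M \<Longrightarrow> 1 \<le> i \<Longrightarrow> 0 < \<sigma> i \<omega>"
  using marks by (simp add: poisson_marks_def)

lemma poisson_marks_finite: "\<omega> \<in> space M \<Longrightarrow> finite {i. 1 \<le> i \<and> \<sigma> i \<omega> \<le> t}"
  using marks by (simp add: poisson_marks_def)

lemma counting_mono:
  assumes "\<omega> \<in> space M" "s \<le> t"
  shows "counting \<sigma> s \<omega> \<le> counting \<sigma> t \<omega>"
  unfolding counting_def
  using assms by (intro card_mono poisson_marks_finite) auto

lemma counting_eq_0_iff:
  assumes "\<omega> \<in> space M"
  shows "counting \<sigma> t \<omega> = 0 \<longleftrightarrow> (\<forall>i\<ge>1. t < \<sigma> i \<omega>)"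
  unfolding counting_def using poisson_marks_finite[OF assms, of t] by auto

lemma measurable_counting:
  assumes [measurable]: "s \<in> borel_measurable M"
  shows "(\<lambda>\<omega>. counting \<sigma> (s \<omega>) \<omega>) \<in> measurable M (count_space UNIV)"
  unfolding counting_def
proof (rule measurable_card)
  fix i
  show "{\<omega> \<in> space M. i \<in> {i. 1 \<le> i \<and> \<sigma> i \<omega> \<le> s \<omega>}} \<in> sets M"
  proof (cases "1 \<le> i")
    case True
    then have [measurable]: "\<sigma> i \<in> borel_measurable M"
      by (rule poisson_marks_measurable)
    show ?thesis by simp
  qed simp
qed

text \<open>
  The Poisson law is prescribed for increments over \<open>(s, t]\<close>. As all marks are strictly positive,
  none is lost by taking \<open>s = 0\<close>.
\<close>

lemma prob_no_mark:
  assumes "0 < r" "0 < t"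
  shows "measure M {\<omega> \<in> space M. counting \<sigma> t \<omega> = 0} = exp (- r * t)"
proof -
  have start: "counting \<sigma> 0 \<omega> = 0" if "\<omega> \<in> space M" for \<omega>
    using that poisson_marks_pos by (simp add: counting_eq_0_iff)
  have meas: "counting \<sigma> u \<in> measurable M (count_space UNIV)" for u
    using measurable_counting[of "\<lambda>_. u"] by simp
  have "distr M (count_space UNIV) (\<lambda>\<omega>. counting \<sigma> t \<omega> - counting \<sigma> 0 \<omega>)
      = measure_pmf (poisson_pmf (r * (t - 0)))"
    using marks assms unfolding poisson_marks_def by blast
  also have "distr M (count_space UNIV) (\<lambda>\<omega>. counting \<sigma> t \<omega> - counting \<sigma> 0 \<omega>)
      = distr M (count_space UNIV) (counting \<sigma> t)"
    by (rule distr_cong) (auto simp: start)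
  finally have "measure (distr M (count_space UNIV) (counting \<sigma> t)) {0} = pmf (poisson_pmf (r * t)) 0"
    by (simp add: pmf.rep_eq)
  moreover have "measure (distr M (count_space UNIV) (counting \<sigma> t)) {0}
      = measure M (counting \<sigma> t -` {0} \<inter> space M)"
    using meas by (rule measure_distr) simp
  moreover have "counting \<sigma> t -` {0} \<inter> space M = {\<omega> \<in> space M. counting \<sigma> t \<omega> = 0}"
    by auto
  ultimately show ?thesis
    using assms by simp
qed

end

section \<open>The clock and the K process\<close>

locale K_process_sources = prob_space M
  for M :: "'w measure" +
  fixes \<gamma> rate :: "'s::countable \<Rightarrow> real"
    and c :: real
    and \<sigma> T :: "'s \<Rightarrow> nat \<Rightarrow> 'w \<Rightarrow> real"
    and T\<^sub>0 :: "'w \<Rightarrow> real"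
  assumes \<gamma>_pos: "0 < \<gamma> z"
    and rate_pos: "0 < rate z"
    and c_nonneg: "0 \<le> c"
    and rate_sum: "(\<Sum>\<^sub>\<infinity>z. ennreal (rate z)) = \<infinity>"
    and marks: "poisson_marks M (rate z) (\<sigma> z)"
    and T0_distr: "distributed M lborel T\<^sub>0 (exponential_density 1)"
    and T_distr: "1 \<le> n \<Longrightarrow> distributed M lborel (T z n) (exponential_density 1)"
    and indep: "independent_sources M \<sigma> T\<^sub>0 T"
begin

abbreviation "\<Gamma> \<equiv> clock \<gamma> c \<sigma> T\<^sub>0 T"
abbreviation "\<Gamma>_left \<equiv> clock_left \<gamma> c \<sigma> T\<^sub>0 T"
abbreviation "X \<equiv> K_process \<gamma> c \<sigma> T\<^sub>0 T"

lemma T0_measurable [measurable]: "T\<^sub>0 \<in> borel_measurable M"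
  using distributed_measurable[OF T0_distr] by simp

lemma T_measurable: "1 \<le> n \<Longrightarrow> T z n \<in> borel_measurable M"
  using distributed_measurable[OF T_distr] by simp

lemma clock_mono:
  assumes "\<omega> \<in> space M"
  shows "mono (\<lambda>t. \<Gamma> y t \<omega>)"
proof (rule monoI)
  fix s t :: real assume "s \<le> t"
  then show "\<Gamma> y s \<omega> \<le> \<Gamma> y t \<omega>"
    unfolding clock_def
    using counting_mono[OF marks assms] c_nonneg
    by (intro add_mono order_refl infsum_mono nonneg_summable_on_complete sum_mono2 ennreal_leI
        mult_left_mono) auto
qed

text \<open>
  The left limit is defined by \<^const>\<open>Lim\<close>, which is meaningful only where the limit exists;
  monotonicity guarantees this for every outcome.
\<close>

lemma clock_tendsto_clock_left:
  assumes "\<omega> \<in> space M"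
  shows "((\<lambda>t. \<Gamma> y t \<omega>) \<longlongrightarrow> \<Gamma>_left y s \<omega>) (at_left s)"
proof -
  note lim = mono_tendsto_at_left[OF clock_mono[OF assms, of y], of s]
  show ?thesis
    unfolding clock_left_def using lim tendsto_Lim[OF _ lim] by simp
qed

lemma clock_le_clock_left:
  assumes "\<omega> \<in> space M" "t < s"
  shows "\<Gamma> y t \<omega> \<le> \<Gamma>_left y s \<omega>"
proof (rule tendsto_lowerbound[OF clock_tendsto_clock_left[OF assms(1)]])
  show "\<forall>\<^sub>F u in at_left s. \<Gamma> y t \<omega> \<le> \<Gamma> y u \<omega>"
    using assms monoD[OF clock_mono[OF assms(1)], of t]
    by (intro eventually_at_leftI[of t]) auto
qed simp

text \<open>
  This lower bound makes an early return to a state unlikely: once \<open>z\<close> has had a mark, the clock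
  has advanced by at least its first holding time.
\<close>

lemma holding_time_le_clock:
  assumes "1 \<le> counting (\<sigma> z) t \<omega>"
  shows "ennreal (\<gamma> z * T z 1 \<omega>) \<le> \<Gamma> y t \<omega>"
proof -
  have "ennreal (\<gamma> z * T z 1 \<omega>) \<le> (\<Sum>i = 1..counting (\<sigma> z) t \<omega>. ennreal (\<gamma> z * T z i \<omega>))"
    using assms by (intro member_le_sum) auto
  also have "\<dots> \<le> (\<Sum>\<^sub>\<infinity>z. \<Sum>i = 1..counting (\<sigma> z) t \<omega>. ennreal (\<gamma> z * T z i \<omega>))"
    by (rule infsum_ennreal_ge_term)
  also have "\<dots> \<le> \<Gamma> y t \<omega>"
    unfolding clock_def by (simp add: add_increasing add_increasing2)
  finally show ?thesis .
qed

subsection \<open>Measurability\<close>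

text \<open>
  The clock is needed at the marks, hence at random times. The number of summands is then
  random; it takes countably many values, and for each of them the sum is measurable.
\<close>

lemma measurable_clock:
  assumes [measurable]: "s \<in> borel_measurable M"
  shows "(\<lambda>\<omega>. \<Gamma> y (s \<omega>) \<omega>) \<in> borel_measurable M"
proof -
  have [measurable]: "(\<lambda>\<omega>. \<Sum>i = 1..counting (\<sigma> z) (s \<omega>) \<omega>. ennreal (\<gamma> z * T z i \<omega>))
      \<in> borel_measurable M" for z
  proof (rule measurable_compose_countable)
    show "(\<lambda>\<omega>. \<Sum>i = 1..n. ennreal (\<gamma> z * T z i \<omega>)) \<in> borel_measurable M" for n :: nat
    proof (rule borel_measurable_sum)
      fix i assume "i \<in> {1..n}"
      then have [measurable]: "T z i \<in> borel_measurable M"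
        by (intro T_measurable) simp
      show "(\<lambda>\<omega>. ennreal (\<gamma> z * T z i \<omega>)) \<in> borel_measurable M"
        by measurable
    qed
    show "(\<lambda>\<omega>. counting (\<sigma> z) (s \<omega>) \<omega>) \<in> measurable M (count_space UNIV)"
      by (rule measurable_counting[OF marks assms])
  qed
  note [measurable] = borel_measurable_infsum_ennreal
  show ?thesis
    unfolding clock_def by measurable
qed

lemma measurable_clock_left:
  assumes [measurable]: "s \<in> borel_measurable M"
  shows "(\<lambda>\<omega>. \<Gamma>_left y (s \<omega>) \<omega>) \<in> borel_measurable M"
proof (rule borel_measurable_LIMSEQ_order)
  show "(\<lambda>\<omega>. \<Gamma> y (s \<omega> - inverse (real (Suc n))) \<omega>) \<in> borel_measurable M" for n
    by (rule measurable_clock) measurable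
  fix \<omega> assume "\<omega> \<in> space M"
  have "filterlim (\<lambda>n. s \<omega> - inverse (real (Suc n))) (at_left (s \<omega>)) sequentially"
  proof (rule tendsto_imp_filterlim_at_left)
    show "(\<lambda>n. s \<omega> - inverse (real (Suc n))) \<longlonglongrightarrow> s \<omega>"
      using tendsto_diff[OF tendsto_const LIMSEQ_inverse_real_of_nat, of "s \<omega>"] by simp
  qed simp
  then show "(\<lambda>n. \<Gamma> y (s \<omega> - inverse (real (Suc n))) \<omega>) \<longlonglongrightarrow> \<Gamma>_left y (s \<omega>) \<omega>"
    by (rule filterlim_compose[OF clock_tendsto_clock_left[OF \<open>\<omega> \<in> space M\<close>]])
qed

lemma pred_constancy_set:
  "Measurable.pred M (\<lambda>\<omega>. ennreal t \<in> constancy_set \<gamma> c \<sigma> T\<^sub>0 T y z \<omega>)"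
proof -
  have [measurable]: "Measurable.pred M
      (\<lambda>\<omega>. \<Gamma>_left y (\<sigma> z i \<omega>) \<omega> \<le> ennreal t \<and> ennreal t < \<Gamma> y (\<sigma> z i \<omega>) \<omega>)" if "i \<in> {1..}" for i
  proof -
    have "\<sigma> z i \<in> borel_measurable M"
      using that by (intro poisson_marks_measurable[OF marks]) simp
    note [measurable] = measurable_clock[OF this, of y] measurable_clock_left[OF this, of y]
    show ?thesis by measurable
  qed
  show ?thesis
    unfolding constancy_set_def UN_iff atLeastLessThan_iff
    by measurable
qed

text \<open>
  Free of the definite description, the event that the process is at \<open>x\<close> is a countable
  combination of the events of \<open>pred_constancy_set\<close>.
\<close>

lemma K_process_eq_Some_iff:
  "X y t \<omega> = Some x \<longleftrightarrow>
     (if t < gamma_bar \<gamma> y * T\<^sub>0 \<omega> then y = Some x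
      else \<forall>z. ennreal t \<in> constancy_set \<gamma> c \<sigma> T\<^sub>0 T y z \<omega> \<longleftrightarrow> z = x)"
proof -
  define P where "P z \<longleftrightarrow> ennreal t \<in> constancy_set \<gamma> c \<sigma> T\<^sub>0 T y z \<omega>" for z
  have "((\<exists>!z. P z) \<and> (THE z. P z) = x) \<longleftrightarrow> (\<forall>z. P z \<longleftrightarrow> z = x)"
    by (metis theI')
  then show ?thesis
    unfolding K_process_def P_def[symmetric] by auto
qed

lemma K_process_event: "{\<omega> \<in> space M. X y t \<omega> = Some x} \<in> events"
proof -
  note [measurable] = pred_constancy_set
  show ?thesis
    unfolding K_process_eq_Some_iff by measurable
qed

subsection \<open>Probabilities of the elementary events\<close>

lemma initial_event: "{\<omega> \<in> space M. \<gamma> x * T\<^sub>0 \<omega> \<le> t} \<in> source_events M \<sigma> T\<^sub>0 T Initial"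
proof -
  have "{\<omega> \<in> space M. \<gamma> x * T\<^sub>0 \<omega> \<le> t} = T\<^sub>0 -` {u. \<gamma> x * u \<le> t} \<inter> space M"
    by auto
  moreover have "{u. \<gamma> x * u \<le> t} \<in> sets borel"
    by measurable
  ultimately show ?thesis
    unfolding source_events.simps by (blast intro: sigma_sets.Basic)
qed

lemma holding_event: "{\<omega> \<in> space M. \<gamma> z * T z n \<omega> \<le> t} \<in> source_events M \<sigma> T\<^sub>0 T (Holding z n)"
proof -
  have "{\<omega> \<in> space M. \<gamma> z * T z n \<omega> \<le> t} = T z n -` {u. \<gamma> z * u \<le> t} \<inter> space M"
    by auto
  moreover have "{u. \<gamma> z * u \<le> t} \<in> sets borel"
    by measurable
  ultimately show ?thesis
    unfolding source_events.simps by (blast intro: sigma_sets.Basic)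
qed

lemma marks_event:
  assumes "0 \<le> t"
  shows "{\<omega> \<in> space M. counting (\<sigma> z) t \<omega> \<in> A} \<in> source_events M \<sigma> T\<^sub>0 T (Marks z)"
proof -
  have "{\<omega> \<in> space M. counting (\<sigma> z) t \<omega> \<in> A} = counting (\<sigma> z) t -` A \<inter> space M"
    by auto
  then show ?thesis
    using assms unfolding source_events.simps by (blast intro: sigma_sets.Basic)
qed

lemma prob_source_events:
  assumes "finite J" "J \<noteq> {}" "J \<subseteq> range Marks \<union> {Initial} \<union> {Holding x n | x n. 1 \<le> n}"
    and "\<And>j. j \<in> J \<Longrightarrow> A j \<in> source_events M \<sigma> T\<^sub>0 T j"
  shows "prob (\<Inter>j\<in>J. A j) = (\<Prod>j\<in>J. prob (A j))"
  using indep assms unfolding independent_sources_def by (intro indep_setsD) auto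

lemma source_event_in_events:
  assumes "j \<in> range Marks \<union> {Initial} \<union> {Holding x n | x n. 1 \<le> n}"
    and "A \<in> source_events M \<sigma> T\<^sub>0 T j"
  shows "A \<in> events"
  using indep assms unfolding independent_sources_def indep_sets_def by blast

lemma prob_initial_Int:
  assumes "j \<in> range Marks \<union> {Holding x n | x n. 1 \<le> n}"
    and "A \<in> source_events M \<sigma> T\<^sub>0 T Initial" "B \<in> source_events M \<sigma> T\<^sub>0 T j"
  shows "prob (A \<inter> B) = prob A * prob B"
proof -
  have j: "j \<noteq> Initial"
    using assms(1) by auto
  let ?E = "\<lambda>i. if i = Initial then A else B"
  have "prob (\<Inter>i\<in>{Initial, j}. ?E i) = (\<Prod>i\<in>{Initial, j}. prob (?E i))"
    by (rule prob_source_events) (use assms in \<open>auto simp del: source_events.simps\<close>)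
  then show ?thesis
    using j by (simp add: Int_commute)
qed

lemma prob_exponential_le:
  assumes "distributed M lborel V (exponential_density 1)" "0 < a" "0 \<le> t"
  shows "prob {\<omega> \<in> space M. a * V \<omega> \<le> t} = 1 - exp (- t / a)"
proof -
  have "{\<omega> \<in> space M. a * V \<omega> \<le> t} = {\<omega> \<in> space M. V \<omega> \<le> t / a}"
    using assms by (auto simp: field_simps)
  then show ?thesis
    using exponential_distributedD_le[OF assms(1), of "t / a"] assms by simp
qed

section \<open>Returning to the initial state\<close>

text \<open>
  Being back at \<open>x\<close> gives a mark of \<open>N\<^sub>x\<close> just before which the clock is at most \<open>t\<close>. If \<open>N\<^sub>x\<close> has
  no mark up to \<open>\<epsilon>\<close>, that mark is later than \<open>\<epsilon>\<close>, so by monotonicity the clock is already at most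
  \<open>t\<close> at time \<open>\<epsilon>\<close>, and so is every holding time that it has accumulated. The set \<open>F\<close> may contain
  \<open>x\<close>, since a state with a mark up to \<open>\<epsilon>\<close> is automatically different from \<open>x\<close> in this case.
\<close>

lemma return_subset:
  assumes "0 \<le> t"
  shows "{\<omega> \<in> space M. \<gamma> x * T\<^sub>0 \<omega> \<le> t \<and> X (Some x) t \<omega> = Some x} \<subseteq>
    {\<omega> \<in> space M. \<gamma> x * T\<^sub>0 \<omega> \<le> t} \<inter>
      ({\<omega> \<in> space M. counting (\<sigma> x) \<epsilon> \<omega> \<in> - {0}}
       \<union> {\<omega> \<in> space M. \<forall>z\<in>F. counting (\<sigma> z) \<epsilon> \<omega> \<in> {0}}
       \<union> (\<Union>z\<in>F. {\<omega> \<in> space M. \<gamma> z * T z 1 \<omega> \<le> t}))"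
proof -
  have "\<exists>z\<in>F. \<gamma> z * T z 1 \<omega> \<le> t"
    if \<omega>: "\<omega> \<in> space M" and "\<gamma> x * T\<^sub>0 \<omega> \<le> t" "X (Some x) t \<omega> = Some x"
      and no_x: "counting (\<sigma> x) \<epsilon> \<omega> = 0" and z: "z \<in> F" "counting (\<sigma> z) \<epsilon> \<omega> \<noteq> 0"
    for \<omega> z
  proof -
    have "ennreal t \<in> constancy_set \<gamma> c \<sigma> T\<^sub>0 T (Some x) x \<omega>"
      using that by (auto simp: K_process_eq_Some_iff gamma_bar_def)
    then obtain i where i: "1 \<le> i" "\<Gamma>_left (Some x) (\<sigma> x i \<omega>) \<omega> \<le> ennreal t"
      by (auto simp: constancy_set_def)
    have "\<epsilon> < \<sigma> x i \<omega>"
      using no_x i(1) by (simp add: counting_eq_0_iff[OF marks \<omega>])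
    have "ennreal (\<gamma> z * T z 1 \<omega>) \<le> \<Gamma> (Some x) \<epsilon> \<omega>"
      using z(2) by (intro holding_time_le_clock) simp
    also have "\<dots> \<le> \<Gamma>_left (Some x) (\<sigma> x i \<omega>) \<omega>"
      by (rule clock_le_clock_left) fact+
    also have "\<dots> \<le> ennreal t" by fact
    finally have "\<gamma> z * T z 1 \<omega> \<le> t"
      using assms by simp
    then show ?thesis
      using z(1) by auto
  qed
  then show ?thesis
    by auto
qed

text \<open>
  The factor \<open>t / \<gamma> x\<close> bounds the probability that the initial holding time is at most \<open>t\<close>, and the
  three terms in parentheses bound the probabilities of the alternatives of \<open>return_subset\<close>.
  The product form is due to their independence of \<open>T\<^sub>0\<close>.
\<close>

lemma prob_return_le:
  assumes F: "finite F" and "0 < \<epsilon>" "0 \<le> t"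
  shows "prob {\<omega> \<in> space M. \<gamma> x * T\<^sub>0 \<omega> \<le> t \<and> X (Some x) t \<omega> = Some x} \<le>
    t / \<gamma> x * (rate x * \<epsilon> + exp (- \<epsilon> * (\<Sum>z\<in>F. rate z)) + t * (\<Sum>z\<in>F. 1 / \<gamma> z))"
proof -
  define A where "A = {\<omega> \<in> space M. \<gamma> x * T\<^sub>0 \<omega> \<le> t}"
  define B where "B = {\<omega> \<in> space M. counting (\<sigma> x) \<epsilon> \<omega> \<in> - {0}}"
  define N where "N z = {\<omega> \<in> space M. counting (\<sigma> z) \<epsilon> \<omega> \<in> {0}}" for z
  define C where "C = {\<omega> \<in> space M. \<forall>z\<in>F. counting (\<sigma> z) \<epsilon> \<omega> \<in> {0}}"
  define D where "D z = {\<omega> \<in> space M. \<gamma> z * T z 1 \<omega> \<le> t}" for z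
  have sources: "A \<in> source_events M \<sigma> T\<^sub>0 T Initial"
    "B \<in> source_events M \<sigma> T\<^sub>0 T (Marks x)"
    "N z \<in> source_events M \<sigma> T\<^sub>0 T (Marks z)"
    "D z \<in> source_events M \<sigma> T\<^sub>0 T (Holding z 1)" for z
    unfolding A_def B_def D_def N_def using assms
    by (intro initial_event marks_event holding_event; simp)+
  have ev: "A \<in> events" "B \<in> events" "N z \<in> events" "D z \<in> events" for z
    by (rule source_event_in_events[OF _ sources(1)], simp,
        rule source_event_in_events[OF _ sources(2)], simp,
        rule source_event_in_events[OF _ sources(3)], simp,
        rule source_event_in_events[OF _ sources(4)], simp)
  \<comment> \<open>Intersecting with \<open>A\<close> covers empty \<open>F\<close>, where the intersection over \<open>F\<close> is not within the space.\<close>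
  have C_eq: "A \<inter> C = A \<inter> (\<Inter>z\<in>F. N z)"
    by (auto simp: A_def C_def N_def)
  have C_ev: "C \<in> events"
  proof -
    have "C = {\<omega> \<in> space M. \<forall>z\<in>F. \<omega> \<in> N z}"
      by (auto simp: C_def N_def)
    also have "\<dots> \<in> events"
      using ev(3) F by (intro sets.sets_Collect_finite_All) auto
    finally show ?thesis .
  qed
  have N: "prob (N z) = exp (- rate z * \<epsilon>)" for z
    unfolding N_def using prob_no_mark[OF marks rate_pos \<open>0 < \<epsilon>\<close>, of z] by simp
  have A: "prob A \<le> t / \<gamma> x"
    unfolding A_def prob_exponential_le[OF T0_distr \<gamma>_pos \<open>0 \<le> t\<close>]
    using one_minus_exp_le[of "t / \<gamma> x"] by simp
  have B: "prob (A \<inter> B) \<le> prob A * (rate x * \<epsilon>)"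
  proof -
    have "B = space M - N x"
      by (auto simp: B_def N_def)
    then have "prob B = 1 - exp (- (rate x * \<epsilon>))"
      using prob_compl[OF ev(3)[of x]] by (simp add: N)
    then show ?thesis
      using prob_initial_Int[OF _ sources(1,2)] one_minus_exp_le[of "rate x * \<epsilon>"]
      by (simp add: mult_left_mono)
  qed
  have C: "prob (A \<inter> C) = prob A * exp (- \<epsilon> * (\<Sum>z\<in>F. rate z))"
  proof -
    \<comment> \<open>Joint independence of all the sources involved: the initial one and the marks of each state in \<open>F\<close>.\<close>
    define E where "E j = (case j of Marks z \<Rightarrow> N z | _ \<Rightarrow> A)" for j :: "'s source"
    have "prob (A \<inter> C) = prob (\<Inter>j\<in>insert Initial (Marks ` F). E j)"
      unfolding C_eq by (simp add: E_def)
    also have "\<dots> = (\<Prod>j\<in>insert Initial (Marks ` F). prob (E j))"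
      by (rule prob_source_events) (use F sources in \<open>auto simp: E_def\<close>)
    also have "\<dots> = prob A * (\<Prod>z\<in>F. prob (N z))"
      using F by (subst prod.insert) (auto simp: E_def prod.reindex inj_on_def)
    also have "\<dots> = prob A * exp (- \<epsilon> * (\<Sum>z\<in>F. rate z))"
      using F by (simp add: N exp_sum sum_distrib_left mult.commute sum_negf flip: exp_sum)
    finally show ?thesis .
  qed
  have D: "prob (A \<inter> D z) \<le> prob A * (t / \<gamma> z)" for z
  proof -
    have "prob (D z) = 1 - exp (- (t / \<gamma> z))"
      unfolding D_def using prob_exponential_le[OF T_distr \<gamma>_pos \<open>0 \<le> t\<close>, of 1 z z] by simp
    then have "prob (D z) \<le> t / \<gamma> z"
      using one_minus_exp_le[of "t / \<gamma> z"] by simp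
    moreover have "prob (A \<inter> D z) = prob A * prob (D z)"
      by (rule prob_initial_Int[OF _ sources(1,4)]) simp
    ultimately show ?thesis
      using mult_left_mono[OF _ measure_nonneg] by metis
  qed
  have "prob {\<omega> \<in> space M. \<gamma> x * T\<^sub>0 \<omega> \<le> t \<and> X (Some x) t \<omega> = Some x}
      \<le> prob ((A \<inter> B) \<union> (A \<inter> C) \<union> (\<Union>z\<in>F. A \<inter> D z))"
  proof (rule finite_measure_mono)
    show "{\<omega> \<in> space M. \<gamma> x * T\<^sub>0 \<omega> \<le> t \<and> X (Some x) t \<omega> = Some x}
        \<subseteq> (A \<inter> B) \<union> (A \<inter> C) \<union> (\<Union>z\<in>F. A \<inter> D z)"
      using return_subset[OF \<open>0 \<le> t\<close>, where x = x and F = F and \<epsilon> = \<epsilon>]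
      unfolding A_def[symmetric] B_def[symmetric] C_def[symmetric] D_def[symmetric] by blast
    show "(A \<inter> B) \<union> (A \<inter> C) \<union> (\<Union>z\<in>F. A \<inter> D z) \<in> events"
      using ev C_ev F by (intro sets.Un sets.Int sets.finite_UN) simp_all
  qed
  also have "\<dots> \<le> prob (A \<inter> B) + prob (A \<inter> C) + (\<Sum>z\<in>F. prob (A \<inter> D z))"
  proof -
    have "prob (\<Union>z\<in>F. A \<inter> D z) \<le> (\<Sum>z\<in>F. prob (A \<inter> D z))"
      using ev F by (intro finite_measure_subadditive_finite) auto
    moreover have "prob ((A \<inter> B) \<union> (A \<inter> C)) \<le> prob (A \<inter> B) + prob (A \<inter> C)"
      using ev C_ev by (intro measure_Un_le) auto
    moreover have "prob ((A \<inter> B) \<union> (A \<inter> C) \<union> (\<Union>z\<in>F. A \<inter> D z))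
        \<le> prob ((A \<inter> B) \<union> (A \<inter> C)) + prob (\<Union>z\<in>F. A \<inter> D z)"
      using ev C_ev F by (intro measure_Un_le sets.finite_UN) auto
    ultimately show ?thesis
      by linarith
  qed
  also have "\<dots> \<le> prob A * (rate x * \<epsilon>) + prob A * exp (- \<epsilon> * (\<Sum>z\<in>F. rate z))
      + (\<Sum>z\<in>F. prob A * (t / \<gamma> z))"
    by (intro add_mono sum_mono B D) (simp add: C)
  also have "\<dots> = prob A * (rate x * \<epsilon> + exp (- \<epsilon> * (\<Sum>z\<in>F. rate z)) + t * (\<Sum>z\<in>F. 1 / \<gamma> z))"
  proof -
    have "(\<Sum>z\<in>F. prob A * (t / \<gamma> z)) = prob A * (t * (\<Sum>z\<in>F. 1 / \<gamma> z))"
      by (simp only: sum_distrib_left) simp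
    then show ?thesis
      by (simp only: distrib_left)
  qed
  also have "\<dots> \<le> t / \<gamma> x * (rate x * \<epsilon> + exp (- \<epsilon> * (\<Sum>z\<in>F. rate z)) + t * (\<Sum>z\<in>F. 1 / \<gamma> z))"
  proof (rule mult_right_mono[OF A])
    have "0 \<le> (\<Sum>z\<in>F. 1 / \<gamma> z)"
      using \<gamma>_pos by (intro sum_nonneg) (simp add: less_imp_le)
    then show "0 \<le> rate x * \<epsilon> + exp (- \<epsilon> * (\<Sum>z\<in>F. rate z)) + t * (\<Sum>z\<in>F. 1 / \<gamma> z)"
      using \<open>0 < \<epsilon>\<close> \<open>0 \<le> t\<close> rate_pos[of x] by simp
  qed
  finally show ?thesis .
qed

text \<open>
  The order of the choices matters: \<open>\<epsilon>\<close> controls the early marks of \<open>N\<^sub>x\<close>, then \<open>F\<close>, depending on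
  \<open>\<epsilon>\<close>, makes it unlikely that all its states are silent up to \<open>\<epsilon>\<close>, and only then \<open>t\<close> tends to 0.
\<close>

lemma prob_return_little_o:
  "((\<lambda>t. prob {\<omega> \<in> space M. \<gamma> x * T\<^sub>0 \<omega> \<le> t \<and> X (Some x) t \<omega> = Some x} / t) \<longlongrightarrow> 0)
    (at_right 0)" (is "((\<lambda>t. ?p t / t) \<longlongrightarrow> 0) _")
proof (rule order_tendstoI)
  fix a :: real assume "a < 0"
  have "\<forall>\<^sub>F t in at_right 0. t \<in> {0<..<1::real}"
    by (rule eventually_at_rightI[of 0 1]) auto
  then show "\<forall>\<^sub>F t in at_right 0. a < ?p t / t"
  proof eventually_elim
    case (elim t)
    then have "0 \<le> ?p t / t" by simp
    with \<open>a < 0\<close> show ?case by linarith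
  qed
next
  fix a :: real assume "0 < a"
  \<comment> \<open>Each of the three terms of \<open>prob_return_le\<close> is to be at most \<open>\<delta>\<close>.\<close>
  define \<delta> where "\<delta> = a * \<gamma> x / 3"
  have \<delta>: "0 < \<delta>"
    using \<open>0 < a\<close> \<gamma>_pos by (simp add: \<delta>_def)
  define \<epsilon> where "\<epsilon> = \<delta> / rate x"
  have \<epsilon>: "0 < \<epsilon>" "rate x * \<epsilon> = \<delta>"
    using \<delta> rate_pos[of x] by (simp_all add: \<epsilon>_def)
  obtain F where F: "finite F" "- ln \<delta> / \<epsilon> < (\<Sum>z\<in>F. rate z)"
    using infsum_ennreal_infinite_obtains[OF rate_sum less_imp_le[OF rate_pos]] .
  have "- ln \<delta> < \<epsilon> * (\<Sum>z\<in>F. rate z)"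
    using F(2) \<epsilon>(1) by (simp add: field_simps)
  then have "exp (- \<epsilon> * (\<Sum>z\<in>F. rate z)) < exp (ln \<delta>)"
    by (subst exp_less_cancel_iff) simp
  then have exp_less: "exp (- \<epsilon> * (\<Sum>z\<in>F. rate z)) < \<delta>"
    using \<delta> by simp
  have "((\<lambda>t. t * (\<Sum>z\<in>F. 1 / \<gamma> z)) \<longlongrightarrow> 0 * (\<Sum>z\<in>F. 1 / \<gamma> z)) (at_right 0)"
    by (intro tendsto_intros)
  then have "\<forall>\<^sub>F t in at_right 0. t * (\<Sum>z\<in>F. 1 / \<gamma> z) < \<delta>"
    using \<delta> by (intro order_tendstoD(2)[of _ 0]) simp_all
  moreover have "\<forall>\<^sub>F t in at_right 0. t \<in> {0<..<1::real}"
    by (rule eventually_at_rightI[of 0 1]) auto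
  ultimately show "\<forall>\<^sub>F t in at_right 0. ?p t / t < a"
  proof eventually_elim
    case (elim t)
    have "?p t \<le> t / \<gamma> x * (rate x * \<epsilon> + exp (- \<epsilon> * (\<Sum>z\<in>F. rate z)) + t * (\<Sum>z\<in>F. 1 / \<gamma> z))"
      using elim by (intro prob_return_le F \<epsilon>) simp
    also have "\<dots> < t / \<gamma> x * (3 * \<delta>)"
      using elim exp_less \<epsilon>(2) \<gamma>_pos by (intro mult_strict_left_mono) auto
    also have "\<dots> = t * a"
      using \<gamma>_pos[of x] by (simp add: \<delta>_def)
    finally show ?case
      using elim by (simp add: field_simps)
  qed
qed

lemma transition_self:
  assumes "0 \<le> t"
  shows "transition M \<gamma> c \<sigma> T\<^sub>0 T (Some x) (Some x) t = exp (- t / \<gamma> x)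
    + prob {\<omega> \<in> space M. \<gamma> x * T\<^sub>0 \<omega> \<le> t \<and> X (Some x) t \<omega> = Some x}"
proof -
  let ?A = "{\<omega> \<in> space M. \<gamma> x * T\<^sub>0 \<omega> \<le> t}"
  let ?X = "{\<omega> \<in> space M. X (Some x) t \<omega> = Some x}"
  have A: "?A \<in> events"
    by measurable
  \<comment> \<open>Outside \<open>?A\<close> the initial holding time is not over, so the process is still at \<open>x\<close>.\<close>
  have "?X = (space M - ?A) \<union> (?A \<inter> ?X)"
    by (auto simp: K_process_eq_Some_iff gamma_bar_def)
  then have "prob ?X = prob ((space M - ?A) \<union> (?A \<inter> ?X))"
    by simp
  also have "\<dots> = prob (space M - ?A) + prob (?A \<inter> ?X)"
    using A K_process_event by (intro finite_measure_Union) auto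
  also have "prob (space M - ?A) = exp (- t / \<gamma> x)"
    unfolding prob_compl[OF A] prob_exponential_le[OF T0_distr \<gamma>_pos assms] by simp
  also have "?A \<inter> ?X = {\<omega> \<in> space M. \<gamma> x * T\<^sub>0 \<omega> \<le> t \<and> X (Some x) t \<omega> = Some x}"
    by auto
  finally show ?thesis
    by (simp add: transition_def)
qed

lemma transition_rate_self:
  "((\<lambda>t. (transition M \<gamma> c \<sigma> T\<^sub>0 T (Some x) (Some x) t - 1) / t) \<longlongrightarrow> - (1 / \<gamma> x)) (at_right 0)"
proof -
  let ?p = "\<lambda>t. prob {\<omega> \<in> space M. \<gamma> x * T\<^sub>0 \<omega> \<le> t \<and> X (Some x) t \<omega> = Some x}"
  have "((\<lambda>t. exp (- t / \<gamma> x)) has_real_derivative - (1 / \<gamma> x)) (at 0)"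
    using \<gamma>_pos[of x] by (auto intro!: derivative_eq_intros)
  then have "((\<lambda>t. (exp (- t / \<gamma> x) - 1) / t) \<longlongrightarrow> - (1 / \<gamma> x)) (at_right 0)"
    by (auto simp: has_field_derivative_iff intro: tendsto_mono[OF at_le])
  then have "((\<lambda>t. (exp (- t / \<gamma> x) - 1) / t + ?p t / t) \<longlongrightarrow> - (1 / \<gamma> x) + 0) (at_right 0)"
    by (intro tendsto_add prob_return_little_o)
  moreover have "\<forall>\<^sub>F t in at_right 0. (exp (- t / \<gamma> x) - 1) / t + ?p t / t
      = (transition M \<gamma> c \<sigma> T\<^sub>0 T (Some x) (Some x) t - 1) / t"
    by (rule eventually_at_rightI[of 0 1])
      (auto simp: transition_self simp flip: add_divide_distrib)
  ultimately show ?thesis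
    by (simp add: tendsto_cong)
qed

end

theorem proposition5p6:
  fixes M :: "'w measure"
    and \<gamma> rate :: "'s::countable \<Rightarrow> real"
    and c :: real
    and \<sigma> T :: "'s \<Rightarrow> nat \<Rightarrow> 'w \<Rightarrow> real"
    and T\<^sub>0 :: "'w \<Rightarrow> real"
    and x :: 's
  assumes "prob_space M"
    and "infinite (UNIV :: 's set)"
    and "\<And>z. 0 < \<gamma> z" and "\<And>z. 0 < rate z" and "0 \<le> c"
    and "(\<Sum>\<^sub>\<infinity>z. ennreal (rate z)) = \<infinity>"
    and "(\<Sum>\<^sub>\<infinity>z. ennreal (rate z * \<gamma> z)) < \<infinity>"
    and "\<And>z. poisson_marks M (rate z) (\<sigma> z)"
    and "distributed M lborel T\<^sub>0 (exponential_density 1)"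
    and "\<And>z n. 1 \<le> n \<Longrightarrow> distributed M lborel (T z n) (exponential_density 1)"
    and "independent_sources M \<sigma> T\<^sub>0 T"
  shows "((\<lambda>t. (transition M \<gamma> c \<sigma> T\<^sub>0 T (Some x) (Some x) t - 1) / t)
           \<longlongrightarrow> - (1 / \<gamma> x)) (at_right 0)"
proof -
  interpret prob_space M by fact
  interpret K_process_sources M \<gamma> rate c \<sigma> T T\<^sub>0
    using assms by unfold_locales auto
  show ?thesis
    by (rule transition_rate_self)
qed

end
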